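(* Let $P$ be an SD program with Herbrand base $B_P=\{p_1,\ldots,p_n\}$, let $\bm{M}_P\in\mathbb{R}^{n\times n}$ be its program matrix and let $\bm{v}_0\in\mathbb{R}^n$ be the initial vector of $P$. Then, for $\bm{m}\in\mathbb{R}^n$, $\bm{m}$ is the vector representing the least model of $P$ if and only if $\bm{m}=\mathsf{FP}(\bm{M}_P\bm{v}_0)$.
   Context: Programs. A definite program $P$ is a finite set of rules $h\leftarrow b_1\wedge\cdots\wedge b_m$ ($m\ge 0$), where $h$ and the $b_i$ are propositional variables and the $b_i$ are pairwise distinct; $head(r)=h$ and $body(r)=\{b_1,\ldots,b_m\}$. A rule with empty body is a fact, written $h\leftarrow$. The Herbrand base $B_P$ is the (finite) set of all propositional variables appearing in $P$. An interpretation is a set $I\subseteq B_P$; it is a model of $P$ if, for every rule of $P$, $\{b_1,\ldots,b_m\}\subseteq I$ implies $h\in I$. The least model is the model contained in every model of $P$. A definite program $P$ is an SD (singly defined) program if $head(r_1)\neq head(r_2)$ for any two distinct rules $r_1,r_2\in P$. Vectors. With $B_P=\{p_1,\ldots,p_n\}$, an interpretation $I$ is represented by the vector $(a_1,\ldots,a_n)^{\mathsf T}$ with $a_i=1$ if $p_i\in I$ and $a_i=0$ otherwise. The initial vector $\bm{v}_0$ of $P$ represents the set of atoms $p_i$ such that the fact $p_i\leftarrow$ is in $P$. Program matrix of an SD program. $\bm{M}_P=(a_{ij})\in\mathbb{R}^{n\times n}$ is given by: (1) if $p_i\leftarrow p_{j_1}\wedge\cdots\wedge p_{j_m}$ with $m\ge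 1$ is in $P$, then $a_{ij_k}=\frac1m$ for $1\le k\le m$; (2) if the fact $p_i\leftarrow$ is in $P$, then $a_{ii}=1$; (3) all other entries are $0$. Thresholding. For $\bm{v}=(a_1,\ldots,a_n)^{\mathsf T}$, $\theta(\bm{v})=(a_1',\ldots,a_n')^{\mathsf T}$ where $a_i'=1$ if $a_i\ge 1$ and $a_i'=0$ otherwise. Fixpoint. Define $\bm{v}_{k+1}=\theta(\bm{M}_P\bm{v}_k)$ for $k\ge 0$, starting from the initial vector $\bm{v}_0$. There is some $k\ge 1$ with $\bm{v}_{k+1}=\bm{v}_k$, and for such $k$ one writes $\mathsf{FP}(\bm{M}_P\bm{v}_0)=\bm{v}_k$. *)

theory Defs
  imports Complex_Main "Jordan_Normal_Form.Matrix"
begin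

datatype 'a rule = Rule (head: 'a) (conjuncts: "'a list")

definition body :: "'a rule \<Rightarrow> 'a set" where
  "body r = set (conjuncts r)"

definition fact_rule :: "'a \<Rightarrow> 'a rule" where
  "fact_rule h = Rule h []"

definition definite_program :: "'a rule set \<Rightarrow> bool" where
  "definite_program P \<longleftrightarrow> finite P \<and> (\<forall>r\<in>P. distinct (conjuncts r))"

definition sd_program :: "'a rule set \<Rightarrow> bool" where
  "sd_program P \<longleftrightarrow>
     definite_program P \<and> (\<forall>r1\<in>P. \<forall>r2\<in>P. r1 \<noteq> r2 \<longrightarrow> head r1 \<noteq> head r2)"

definition herbrand_base :: "'a rule set \<Rightarrow> 'a set" where
  "herbrand_base P = (\<Union>r\<in>P. insert (head r) (body r))"

definition is_model :: "'a rule set \<Rightarrow> 'a set \<Rightarrow> bool" where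
  "is_model P I \<longleftrightarrow> I \<subseteq> herbrand_base P \<and> (\<forall>r\<in>P. body r \<subseteq> I \<longrightarrow> head r \<in> I)"

definition is_least_model :: "'a rule set \<Rightarrow> 'a set \<Rightarrow> bool" where
  "is_least_model P I \<longleftrightarrow> is_model P I \<and> (\<forall>J. is_model P J \<longrightarrow> I \<subseteq> J)"

definition least_model :: "'a rule set \<Rightarrow> 'a set" where
  "least_model P = (THE I. is_least_model P I)"

lemma ex1_least_model: "\<exists>!I. is_least_model P I"
proof -
  have "is_model P (herbrand_base P)"
    by (auto simp: is_model_def herbrand_base_def)
  then have "is_least_model P (\<Inter>{I. is_model P I})"
    unfolding is_least_model_def is_model_def by blast
  then show ?thesis
    unfolding is_least_model_def by blast
qed

lemma is_least_model_least_model: "is_least_model P (least_model P)"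
  unfolding least_model_def by (rule theI'[OF ex1_least_model])

text \<open>Below, the list \<open>ps\<close> enumerates the Herbrand base: the \<open>i\<close>-th variable
  (counting from 0, as do vector and matrix indices) is \<open>ps ! i\<close>.\<close>

definition interp_vec :: "'a list \<Rightarrow> 'a set \<Rightarrow> real vec" where
  "interp_vec ps I = vec (length ps) (\<lambda>i. if ps ! i \<in> I then 1 else 0)"

definition initial_vec :: "'a rule set \<Rightarrow> 'a list \<Rightarrow> real vec" where
  "initial_vec P ps = interp_vec ps {h. fact_rule h \<in> P}"

text \<open>The rule of \<open>P\<close> with a given head; meaningful only if there is exactly one, which for
  an SD program holds as soon as there is some such rule.\<close>

definition rule_for :: "'a rule set \<Rightarrow> 'a \<Rightarrow> 'a rule" where
  "rule_for P h = (THE r. r \<in> P \<and> head r = h)"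

definition program_matrix :: "'a rule set \<Rightarrow> 'a list \<Rightarrow> real mat" where
  "program_matrix P ps = mat (length ps) (length ps) (\<lambda>(i, j).
     if (\<exists>r\<in>P. head r = ps ! i \<and> ps ! j \<in> body r)
       then 1 / real (card (body (rule_for P (ps ! i))))
     else if i = j \<and> fact_rule (ps ! i) \<in> P then 1
     else 0)"

definition threshold :: "real vec \<Rightarrow> real vec" where
  "threshold v = map_vec (\<lambda>a. if a \<ge> 1 then 1 else 0) v"

definition iter_vec :: "real mat \<Rightarrow> real vec \<Rightarrow> nat \<Rightarrow> real vec" where
  "iter_vec M v k = ((\<lambda>w. threshold (M *\<^sub>v w)) ^^ k) v"

definition is_FP :: "real mat \<Rightarrow> real vec \<Rightarrow> real vec \<Rightarrow> bool" where
  "is_FP M v w \<longleftrightarrow> (\<exists>k\<ge>1. iter_vec M v (Suc k) = iter_vec M v k \<and> w = iter_vec M v k)"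

definition FP :: "real mat \<Rightarrow> real vec \<Rightarrow> real vec" where
  "FP M v = (THE w. is_FP M v w)"

lemma iter_vec_stable:
  assumes "iter_vec M v (Suc k) = iter_vec M v k" and "k \<le> l"
  shows "iter_vec M v l = iter_vec M v k"
  using assms(2)
proof (induction l rule: dec_induct)
  case (step l)
  then show ?case using assms(1) by (simp add: iter_vec_def)
qed simp

lemma is_FP_unique:
  assumes "is_FP M v w" and "is_FP M v w'"
  shows "w = w'"
proof -
  obtain k where k: "iter_vec M v (Suc k) = iter_vec M v k" "w = iter_vec M v k"
    using assms(1) by (auto simp: is_FP_def)
  obtain l where l: "iter_vec M v (Suc l) = iter_vec M v l" "w' = iter_vec M v l"
    using assms(2) by (auto simp: is_FP_def)
  show ?thesis
    using iter_vec_stable[OF k(1), of l] iter_vec_stable[OF l(1), of k] k(2) l(2)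
    by (cases "k \<le> l") auto
qed

lemma FP_eqI: "is_FP M v w \<Longrightarrow> FP M v = w"
  unfolding FP_def by (blast intro: the_equality is_FP_unique)

end

(* Restricted to 0/1-vectors, one thresholded multiplication by the program matrix is the
   immediate-consequence operator, except that a fact is retained rather than derived.  Since the
   iteration starts from the set of facts, it is increasing and stays below every model, so it
   becomes stationary in the finite Herbrand base, at a model that is therefore the least one. *)
theory Submission
  imports Defs
begin

text \<open>The row of a fact has its only nonzero entry, 1, on the diagonal, so multiplication
  copies that coordinate. Hence a fact survives only if it is already in \<open>S\<close>, and the
  second set is restricted to nonempty bodies.\<close>

definition consequences :: "'a rule set \<Rightarrow> 'a set \<Rightarrow> 'a set" where
  "consequences P S =
     {h \<in> S. fact_rule h \<in> P} \<union> {head r | r. r \<in> P \<and> body r \<noteq> {} \<and> body r \<subseteq> S}"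

lemma mono_consequences: "mono (consequences P)"
  by (rule monoI) (auto simp: consequences_def)

lemma finite_body [simp]: "finite (body r)"
  by (simp add: body_def)

lemma body_empty_iff: "body r = {} \<longleftrightarrow> r = fact_rule (head r)"
  by (cases r) (auto simp: body_def fact_rule_def)

lemma rule_for_eq:
  assumes "sd_program P" and "r \<in> P"
  shows "rule_for P (head r) = r"
  using assms unfolding rule_for_def sd_program_def by (intro the_equality) auto

lemma sum_nth_distinct:
  assumes "distinct xs"
  shows "(\<Sum>j = 0..<length xs. f (xs ! j)) = (\<Sum>x\<in>set xs. f x)"
  by (rule sum.reindex_bij_betw) (simp add: assms bij_betw_nth atLeast0LessThan)

text \<open>Distinctness of \<open>ps\<close> lets the sum run over atoms instead of indices, so
  that the index test \<open>i = j\<close> becomes an equation between atoms.\<close>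

lemma program_matrix_mult_interp_vec:
  assumes "distinct ps" and "i < length ps"
  shows "(program_matrix P ps *\<^sub>v interp_vec ps S) $ i =
    (\<Sum>x\<in>set ps. (if \<exists>r\<in>P. head r = ps ! i \<and> x \<in> body r
         then 1 / real (card (body (rule_for P (ps ! i))))
       else if x = ps ! i \<and> fact_rule (ps ! i) \<in> P then 1 else 0) * (if x \<in> S then 1 else 0))"
  unfolding sum_nth_distinct[OF assms(1), symmetric]
  using assms
  by (auto simp: program_matrix_def interp_vec_def scalar_prod_def nth_eq_iff_index_eq
      intro!: sum.cong)

text \<open>For a rule with body of size m > 0, the row sums to the number of body atoms in
  \<open>S\<close> divided by m, which reaches 1 exactly when the whole body lies in
  \<open>S\<close>. A fact row copies its coordinate, and an atom heading no rule has a zero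
  row.\<close>

lemma program_matrix_mult_ge_1_iff:
  assumes sd: "sd_program P" and ps: "distinct ps" "set ps = herbrand_base P"
    and i: "i < length ps"
  shows "(program_matrix P ps *\<^sub>v interp_vec ps S) $ i \<ge> 1 \<longleftrightarrow> ps ! i \<in> consequences P S"
proof (cases "\<exists>r\<in>P. head r = ps ! i")
  case True
  then obtain r where r: "r \<in> P" "head r = ps ! i" by blast
  have uniq: "q = r" if "q \<in> P" "head q = ps ! i" for q
    using sd r that unfolding sd_program_def by metis
  have rule_for: "rule_for P (ps ! i) = r"
    using rule_for_eq[OF sd r(1)] r(2) by simp
  have body_iff: "(\<exists>q\<in>P. head q = ps ! i \<and> x \<in> body q) \<longleftrightarrow> x \<in> body r" for x
    using r by (auto dest: uniq)
  have fact_iff: "fact_rule (ps ! i) \<in> P \<longleftrightarrow> body r = {}"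
  proof
    assume "fact_rule (ps ! i) \<in> P"
    then have "fact_rule (ps ! i) = r"
      by (intro uniq) (simp_all add: fact_rule_def)
    then show "body r = {}"
      by (auto simp: body_def fact_rule_def)
  next
    assume "body r = {}"
    then show "fact_rule (ps ! i) \<in> P"
      using r by (simp add: body_empty_iff)
  qed
  have cons_iff: "ps ! i \<in> consequences P S \<longleftrightarrow>
      (if body r = {} then ps ! i \<in> S else body r \<subseteq> S)"
  proof -
    have "(\<exists>q. ps ! i = head q \<and> q \<in> P \<and> body q \<noteq> {} \<and> body q \<subseteq> S) \<longleftrightarrow>
        body r \<noteq> {} \<and> body r \<subseteq> S"
      using r uniq by metis
    then show ?thesis
      by (auto simp: consequences_def fact_iff)
  qed
  have entry: "(program_matrix P ps *\<^sub>v interp_vec ps S) $ i =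
    (\<Sum>x\<in>set ps. (if x \<in> body r then 1 / real (card (body r))
       else if x = ps ! i \<and> body r = {} then 1 else 0) * (if x \<in> S then 1 else 0))"
    unfolding program_matrix_mult_interp_vec[OF ps(1) i] body_iff rule_for fact_iff ..
  show ?thesis
  proof (cases "body r = {}")
    case True
    have "(program_matrix P ps *\<^sub>v interp_vec ps S) $ i =
        (\<Sum>x\<in>set ps. if x = ps ! i then (if x \<in> S then 1 else 0) else 0)"
      unfolding entry using True by (intro sum.cong) auto
    also have "\<dots> = (if ps ! i \<in> S then 1 else 0)"
      using i by simp
    finally show ?thesis
      using True cons_iff by simp
  next
    case False
    \<comment> \<open>Every body atom is enumerated by \<open>ps\<close>, so the sum over
      \<open>set ps\<close> counts all of \<open>body r \<inter> S\<close>.\<close>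
    have "body r \<subseteq> set ps"
      using r(1) ps(2) by (auto simp: herbrand_base_def)
    then have "set ps \<inter> (body r \<inter> S) = body r \<inter> S"
      by blast
    moreover have "(program_matrix P ps *\<^sub>v interp_vec ps S) $ i =
        (\<Sum>x\<in>set ps. if x \<in> body r \<inter> S then 1 / real (card (body r)) else 0)"
      unfolding entry using False by (intro sum.cong) auto
    ultimately have "(program_matrix P ps *\<^sub>v interp_vec ps S) $ i =
        real (card (body r \<inter> S)) / real (card (body r))"
      by (simp add: sum.inter_restrict[symmetric] del: Int_iff)
    moreover have "card (body r) > 0"
      using False by (simp add: card_gt_0_iff)
    ultimately have "(program_matrix P ps *\<^sub>v interp_vec ps S) $ i \<ge> 1 \<longleftrightarrow>
        card (body r) \<le> card (body r \<inter> S)"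
      by (simp add: le_divide_eq)
    \<comment> \<open>A subset of a finite set with at least as many elements is the whole
      set.\<close>
    also have "\<dots> \<longleftrightarrow> body r \<subseteq> S"
      using card_seteq[of "body r" "body r \<inter> S"] by (auto simp: Int_absorb2)
    finally show ?thesis
      using False cons_iff by simp
  qed
next
  case False
  then have "fact_rule (ps ! i) \<notin> P"
    by (auto simp: fact_rule_def)
  with False show ?thesis
    by (auto simp: program_matrix_mult_interp_vec[OF ps(1) i] consequences_def)
qed

lemma threshold_program_matrix_mult:
  assumes "sd_program P" and "distinct ps" and "set ps = herbrand_base P"
  shows "threshold (program_matrix P ps *\<^sub>v interp_vec ps S) = interp_vec ps (consequences P S)"
proof (rule eq_vecI)
  have dim: "dim_row (program_matrix P ps) = length ps"
    by (simp add: program_matrix_def)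
  then show "dim_vec (threshold (program_matrix P ps *\<^sub>v interp_vec ps S)) =
      dim_vec (interp_vec ps (consequences P S))"
    by (simp add: threshold_def interp_vec_def)
  fix i assume "i < dim_vec (interp_vec ps (consequences P S))"
  then have i: "i < length ps"
    by (simp add: interp_vec_def)
  then have "i < dim_vec (program_matrix P ps *\<^sub>v interp_vec ps S)"
    by (simp add: dim)
  then have "threshold (program_matrix P ps *\<^sub>v interp_vec ps S) $ i =
      (if (program_matrix P ps *\<^sub>v interp_vec ps S) $ i \<ge> 1 then 1 else 0)"
    unfolding threshold_def by (rule index_map_vec)
  then show "threshold (program_matrix P ps *\<^sub>v interp_vec ps S) $ i =
      interp_vec ps (consequences P S) $ i"
    using i unfolding program_matrix_mult_ge_1_iff[OF assms i] by (simp add: interp_vec_def)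
qed

lemma iter_vec_program_matrix:
  assumes "sd_program P" and "distinct ps" and "set ps = herbrand_base P"
  shows "iter_vec (program_matrix P ps) (initial_vec P ps) k =
    interp_vec ps ((consequences P ^^ k) {h. fact_rule h \<in> P})"
  by (induction k) (simp_all add: iter_vec_def initial_vec_def threshold_program_matrix_mult[OF assms])

text \<open>The iterates form an increasing chain of subsets of the finite set of heads, so two of
  them coincide, and monotonicity forces all those in between to agree.\<close>

lemma consequences_iterates_stabilize:
  assumes "finite P"
  shows "\<exists>k\<ge>1. (consequences P ^^ Suc k) {h. fact_rule h \<in> P} =
    (consequences P ^^ k) {h. fact_rule h \<in> P}"
proof -
  let ?S = "\<lambda>k. (consequences P ^^ k) {h. fact_rule h \<in> P}"
  have "?S k \<subseteq> ?S (Suc k)" for k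
  proof (induction k)
    case 0
    \<comment> \<open>The starting set consists of facts only, and facts are retained.\<close>
    show ?case by (auto simp: consequences_def)
  next
    case (Suc k)
    then show ?case using monoD[OF mono_consequences] by simp
  qed
  then have mono: "mono ?S"
    by (simp add: mono_iff_le_Suc)
  have "?S k \<subseteq> head ` P" for k
    by (cases k) (force simp: consequences_def fact_rule_def)+
  then have "finite (range ?S)"
    using assms by (intro finite_subset[of "range ?S" "Pow (head ` P)"]) blast+
  then have "\<not> inj ?S"
    using finite_imageD infinite_UNIV_nat by blast
  then obtain i j where ij: "i < j" "?S i = ?S j"
    unfolding inj_def by (metis linorder_neqE_nat)
  \<comment> \<open>Squeeze:
    \<open>?S i \<subseteq> ?S (Suc i) \<subseteq> ?S j = ?S i\<close>.\<close>
  have "?S (Suc i) = ?S i"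
  proof (rule equalityI)
    show "?S (Suc i) \<subseteq> ?S i"
      unfolding ij(2) using ij(1) by (intro monoD[OF mono]) simp
    show "?S i \<subseteq> ?S (Suc i)"
      by (rule monoD[OF mono]) simp
  qed
  \<comment> \<open>Shifting by one secures an index of at least 1 even when \<open>i\<close> is
    0.\<close>
  then have "?S (Suc (Suc i)) = ?S (Suc i)"
    by simp
  then show ?thesis
    by (intro exI[of _ "Suc i"]) simp
qed

text \<open>A model contains all facts and is closed under the rules, so no iteration step leaves
  it. This gives minimality, and with the Herbrand base as the model it also bounds the
  iterates.\<close>

lemma consequences_iterates_subset_model:
  assumes "is_model P J"
  shows "(consequences P ^^ k) {h. fact_rule h \<in> P} \<subseteq> J"
proof (induction k)
  case 0
  have "h \<in> J" if "fact_rule h \<in> P" for h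
    using assms that unfolding is_model_def by (fastforce simp: fact_rule_def body_def)
  then show ?case by auto
next
  case (Suc k)
  then show ?case
    using assms by (auto simp: consequences_def is_model_def)
qed

text \<open>The fixpoint equation yields closure under rules with nonempty body. Facts have to come
  from the second hypothesis, since the operator never creates them: the empty set is always a
  fixpoint.\<close>

lemma is_model_fixpoint:
  assumes "consequences P S = S" and "{h. fact_rule h \<in> P} \<subseteq> S" and "S \<subseteq> herbrand_base P"
  shows "is_model P S"
  unfolding is_model_def
proof (intro conjI ballI impI assms(3))
  fix r assume r: "r \<in> P" "body r \<subseteq> S"
  show "head r \<in> S"
  proof (cases "body r = {}")
    case True
    then have "fact_rule (head r) \<in> P"
      using r(1) by (simp add: body_empty_iff)
    then show ?thesis using assms(2) by blast
  next
    case False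
    then have "head r \<in> consequences P S"
      using r by (auto simp: consequences_def)
    then show ?thesis by (simp add: assms(1))
  qed
qed

lemma least_model_eq_iterate:
  assumes "(consequences P ^^ Suc k) {h. fact_rule h \<in> P} =
    (consequences P ^^ k) {h. fact_rule h \<in> P}"
  shows "least_model P = (consequences P ^^ k) {h. fact_rule h \<in> P}"
proof (rule equalityI)
  let ?F = "{h. fact_rule h \<in> P}"
  \<comment> \<open>The facts, present at the start, persist through every step.\<close>
  have "?F \<subseteq> (consequences P ^^ k) ?F"
  proof (induction k)
    case (Suc k)
    then show ?case by (auto simp: consequences_def)
  qed simp
  moreover have "is_model P (herbrand_base P)"
    by (auto simp: is_model_def herbrand_base_def)
  ultimately have "is_model P ((consequences P ^^ k) ?F)"
    using assms consequences_iterates_subset_model[of P "herbrand_base P" k]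
    by (intro is_model_fixpoint) simp_all
  then show "least_model P \<subseteq> (consequences P ^^ k) ?F"
    using is_least_model_least_model[of P] by (simp add: is_least_model_def)
  show "(consequences P ^^ k) ?F \<subseteq> least_model P"
    using is_least_model_least_model[of P]
    by (intro consequences_iterates_subset_model) (simp add: is_least_model_def)
qed

theorem theorem1:
  fixes P :: "'a rule set" and ps :: "'a list" and n :: nat and m :: "real vec"
  assumes "sd_program P"
    and "distinct ps" and "length ps = n" and "set ps = herbrand_base P"
    and "m \<in> carrier_vec n"
  shows "m = interp_vec ps (least_model P) \<longleftrightarrow> m = FP (program_matrix P ps) (initial_vec P ps)"
proof -
  have "finite P"
    using assms(1) by (simp add: sd_program_def definite_program_def)
  then obtain k where k: "k \<ge> 1"
    "(consequences P ^^ Suc k) {h. fact_rule h \<in> P} = (consequences P ^^ k) {h. fact_rule h \<in> P}"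
    using consequences_iterates_stabilize by blast
  \<comment> \<open>The limit of the vector iteration is unique, so exhibiting the least model's
    vector as a limit identifies it with \<open>FP\<close>, and the two equations for
    \<open>m\<close> become the same.\<close>
  have "is_FP (program_matrix P ps) (initial_vec P ps) (interp_vec ps (least_model P))"
    unfolding is_FP_def iter_vec_program_matrix[OF assms(1,2,4)] least_model_eq_iterate[OF k(2)]
    using k by metis
  then show ?thesis
    by (simp add: FP_eqI)
qed

end
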